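(* Let $n,p,k,q$ be integers with $n\ge 3$, $p\ge 2$, $2\le k\le n-1$ and $q\ge 1$. Then the braids $$\beta_V=(\sigma_{n-1}\sigma_{n-2}\cdots\sigma_2\sigma_1)^p(\sigma_{n-1}\sigma_{n-2}\cdots\sigma_{n-k+1})^{qk}$$ and $$\beta_{BK}=(\sigma_1\sigma_2\cdots\sigma_{k-1})^{qk}(\sigma_1\sigma_2\cdots\sigma_{n-1})^{p}$$ in $B_n$ are Markov equivalent; in particular their closures are isotopic links in $S^3$. (That is, the definitions of twisted torus knots due to Vafaee and to Birman--Kofman agree.)
   Context: $B_n$ is the braid group on $n$ strands with Artin generators $\sigma_1,\dots,\sigma_{n-1}$; $\sigma_i$ corresponds to strand $i+1$ crossing over strand $i$. Two braids are Markov equivalent if they are related by a finite sequence of braid relations, conjugations, and stabilizations/destabilizations (a stabilization replaces a braid word $\omega$ on $m$ strands by $\omega\sigma_m^{\pm1}$ on $m+1$ strands; a destabilization is the reverse). *)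

theory Defs
  imports "HOL-Analysis.Analysis"
begin

section \<open>Braids and Markov equivalence\<close>

text \<open>
  An element of \<open>B\<^sub>n\<close> is given by a word in the Artin generators and their inverses:
  the letter \<open>(i, True)\<close> is \<open>\<sigma>\<^sub>i\<close>, and \<open>(i, False)\<close> is its inverse. Words that represent the
  same element of \<open>B\<^sub>n\<close> are identified by Markov equivalence below.
\<close>

type_synonym letter = "nat \<times> bool"
type_synonym braid_word = "letter list"

definition sigma :: "nat \<Rightarrow> letter" where
  "sigma i = (i, True)"

definition is_braid :: "nat \<Rightarrow> braid_word \<Rightarrow> bool" where
  "is_braid n w \<longleftrightarrow> n \<ge> 1 \<and> (\<forall>(i, b) \<in> set w. 1 \<le> i \<and> i < n)"

definition word_inv :: "braid_word \<Rightarrow> braid_word" where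
  "word_inv w = rev (map (\<lambda>(i, b). (i, \<not> b)) w)"

definition word_pow :: "braid_word \<Rightarrow> nat \<Rightarrow> braid_word" where
  "word_pow w p = concat (replicate p w)"

inductive braid_relation :: "braid_word \<Rightarrow> braid_word \<Rightarrow> bool" where
  cancel: "braid_relation [(i, b), (i, \<not> b)] []"
| commute: "i + 2 \<le> j \<Longrightarrow> braid_relation [sigma i, sigma j] [sigma j, sigma i]"
| braid: "braid_relation [sigma i, sigma (i + 1), sigma i] [sigma (i + 1), sigma i, sigma (i + 1)]"

text \<open>The first component of a pair is the number of strands.\<close>

inductive markov_move :: "nat \<times> braid_word \<Rightarrow> nat \<times> braid_word \<Rightarrow> bool" where
  relation: "braid_relation r s \<Longrightarrow> is_braid n (u @ r @ v) \<Longrightarrow> is_braid n (u @ s @ v) \<Longrightarrow>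
    markov_move (n, u @ r @ v) (n, u @ s @ v)"
| conjugation: "is_braid n w \<Longrightarrow> is_braid n g \<Longrightarrow>
    markov_move (n, w) (n, g @ w @ word_inv g)"
| stabilization: "is_braid m w \<Longrightarrow> markov_move (m, w) (m + 1, w @ [(m, b)])"

definition markov_equivalent :: "nat \<times> braid_word \<Rightarrow> nat \<times> braid_word \<Rightarrow> bool" where
  "markov_equivalent x y \<longleftrightarrow>
    is_braid (fst x) (snd x) \<and> is_braid (fst y) (snd y) \<and> equivclp markov_move x y"

section \<open>Closures of braids as links in the 3-sphere\<close>

text \<open>
  The strands run in \<open>\<complex> \<times> [0,1]\<close>, with the strand positions at \<open>1, \<dots>, n \<in> \<complex>\<close> and the letters
  of the word taken in order of increasing time. A diagram is obtained by projecting along the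
  imaginary axis, with time running down the page and larger imaginary part nearer to the
  reader. During \<open>\<sigma>\<^sub>i\<close> the points at \<open>i\<close> and \<open>i + 1\<close> make a counterclockwise half turn about
  their midpoint, so that the strand starting at \<open>i + 1\<close> crosses over the one starting at \<open>i\<close>.
\<close>

definition letter_path :: "letter \<Rightarrow> real \<Rightarrow> nat \<Rightarrow> complex" where
  "letter_path l s j =
    (let i = fst l; e = (if snd l then 1 else -1); c = of_nat i + 1/2
     in if j = i then c - cis (e * pi * s) / 2
        else if j = i + 1 then c + cis (e * pi * s) / 2
        else of_nat j)"

text \<open>The set of points of the geometric braid at time \<open>t \<in> [0,1)\<close>; each letter takes equal time.\<close>

definition braid_slice :: "nat \<Rightarrow> braid_word \<Rightarrow> real \<Rightarrow> complex set" where
  "braid_slice n w t =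
    (if w = [] then of_nat ` {1..n}
     else let x = t * real (length w)
          in letter_path (w ! nat \<lfloor>x\<rfloor>) (frac x) ` {1..n})"

abbreviation S3 :: "(complex \<times> complex) set" where
  "S3 \<equiv> sphere 0 1"

text \<open>
  Gluing the ends of \<open>\<complex> \<times> [0,1]\<close> gives the open solid torus \<open>\<complex> \<times> S\<^sup>1\<close>, which this map
  identifies with the complement of the unknotted braid axis \<open>{(z, 0). |z| = 1}\<close> in \<open>S\<^sup>3\<close>,
  preserving orientations.
\<close>

definition solid_torus_embedding :: "complex \<Rightarrow> real \<Rightarrow> complex \<times> complex" where
  "solid_torus_embedding z t = (z, cis (2 * pi * t)) /\<^sub>R norm (z, cis (2 * pi * t))"

definition braid_closure :: "nat \<Rightarrow> braid_word \<Rightarrow> (complex \<times> complex) set" where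
  "braid_closure n w = (\<Union>t \<in> {0..<1}. (\<lambda>z. solid_torus_embedding z t) ` braid_slice n w t)"

definition ambient_isotopic_S3 :: "(complex \<times> complex) set \<Rightarrow> (complex \<times> complex) set \<Rightarrow> bool" where
  "ambient_isotopic_S3 L L' \<longleftrightarrow> L \<subseteq> S3 \<and> L' \<subseteq> S3 \<and>
    (\<exists>H :: real \<Rightarrow> complex \<times> complex \<Rightarrow> complex \<times> complex.
       continuous_on ({0..1} \<times> S3) (\<lambda>(t, x). H t x) \<and>
       (\<forall>t \<in> {0..1}. \<exists>g. homeomorphism S3 S3 (H t) g) \<and>
       (\<forall>x \<in> S3. H 0 x = x) \<and>
       H 1 ` L = L')"

section \<open>The two families of braids\<close>

text \<open>\<open>\<sigma>\<^sub>b \<sigma>\<^bsub>b-1\<^esub> \<dots> \<sigma>\<^sub>a\<close> and \<open>\<sigma>\<^sub>a \<sigma>\<^bsub>a+1\<^esub> \<dots> \<sigma>\<^sub>b\<close>\<close>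

definition sigma_down :: "nat \<Rightarrow> nat \<Rightarrow> braid_word" where
  "sigma_down b a = rev (map sigma [a..<b + 1])"

definition sigma_up :: "nat \<Rightarrow> nat \<Rightarrow> braid_word" where
  "sigma_up a b = map sigma [a..<b + 1]"

definition beta_V :: "nat \<Rightarrow> nat \<Rightarrow> nat \<Rightarrow> nat \<Rightarrow> braid_word" where
  "beta_V n p k q =
    word_pow (sigma_down (n - 1) 1) p @ word_pow (sigma_down (n - 1) (n - k + 1)) (q * k)"

definition beta_BK :: "nat \<Rightarrow> nat \<Rightarrow> nat \<Rightarrow> nat \<Rightarrow> braid_word" where
  "beta_BK n p k q =
    word_pow (sigma_up 1 (k - 1)) (q * k) @ word_pow (sigma_up 1 (n - 1)) p"

end

theory Submission
  imports Defs
begin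

text \<open>
  Let \<open>flip\<close> replace every \<open>\<sigma>\<^sub>i\<close> by \<open>\<sigma>\<^bsub>n-i\<^esub>\<close>. If \<open>\<beta>\<^sub>V = u v\<close> with the two powers \<open>u\<close> and \<open>v\<close>, then
  \<open>\<beta>\<^bsub>BK\<^esub>\<close> is literally the word \<open>flip v \<cdot> flip u\<close>. Hence it suffices to understand what \<open>flip\<close> and a
  cyclic rotation do to a braid word, and to its closure.

  In the braid group, \<open>flip\<close> is conjugation by the half twist \<open>\<Delta>\<close> (\<open>half_twist_flip\<close>, for
  positive words) and a cyclic rotation is a conjugation as well. So the two braids are even conjugate in \<open>B\<^sub>n\<close>: Markov
  equivalence requires no stabilization (\<open>markov_equivalent_rotate_flip\<close>).

  The closures are not compared through Markov moves. The half turn \<open>z \<mapsto> n + 1 - z\<close> of the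
  plane maps the geometric braid of \<open>w\<close> exactly onto the one of \<open>flip w\<close>
  (\<open>letter_path_flip_image\<close>), and since all letters take equal time, rotating the word is a shift
  of the time coordinate. Therefore one closure is the image of the other under a rotation of the
  solid torus \<open>\<complex> \<times> S\<^sup>1\<close> in both factors (\<open>braid_closure_rotate_flip\<close>). Such rotations, about any
  centre in \<open>\<complex>\<close>, extend over the braid axis to homeomorphisms of \<open>S\<^sup>3\<close> and are joined to the
  identity by turning gradually (\<open>ambient_isotopic_half_turn\<close>).
\<close>

section \<open>Equality in the braid group\<close>

text \<open>
  Equality in \<open>B\<^sub>n\<close>. The surrounding words \<open>u\<close> and \<open>v\<close> are arbitrary, which makes this a congruence
  on all words; if one side is a word on \<open>n\<close> strands, then so is every word in between.
\<close>

inductive braid_eq :: "nat \<Rightarrow> braid_word \<Rightarrow> braid_word \<Rightarrow> bool" for n where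
  rel: "braid_relation r s \<Longrightarrow> is_braid n r \<Longrightarrow> is_braid n s \<Longrightarrow> braid_eq n (u @ r @ v) (u @ s @ v)"
| refl: "braid_eq n u u"
| sym: "braid_eq n u v \<Longrightarrow> braid_eq n v u"
| trans [trans]: "braid_eq n u v \<Longrightarrow> braid_eq n v w \<Longrightarrow> braid_eq n u w"

lemma is_braid_append: "is_braid n (u @ v) \<longleftrightarrow> is_braid n u \<and> is_braid n v"
  by (auto simp: is_braid_def)

lemma is_braid_word_inv: "is_braid n (word_inv w) \<longleftrightarrow> is_braid n w"
  by (force simp: is_braid_def word_inv_def)

lemma braid_eq_is_braid_iff: "braid_eq n u v \<Longrightarrow> is_braid n u \<longleftrightarrow> is_braid n v"
  by (induction rule: braid_eq.induct) (auto simp: is_braid_append)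

lemma braid_eq_context: "braid_eq n u v \<Longrightarrow> braid_eq n (a @ u @ b) (a @ v @ b)"
proof (induction rule: braid_eq.induct)
  case (rel r s u v)
  then show ?case
    using braid_eq.rel[of r s n "a @ u" "v @ b"] by simp
qed (auto intro: braid_eq.intros)

lemma braid_eq_append1: "braid_eq n u v \<Longrightarrow> braid_eq n (a @ u) (a @ v)"
  using braid_eq_context[of n u v a "[]"] by simp

lemma braid_eq_append2: "braid_eq n u v \<Longrightarrow> braid_eq n (u @ b) (v @ b)"
  using braid_eq_context[of n u v "[]" b] by simp

lemma braid_eq_imp_equivclp:
  "braid_eq n u v \<Longrightarrow> is_braid n u \<Longrightarrow> equivclp markov_move (n, u) (n, v)"
proof (induction rule: braid_eq.induct)
  case (rel r s u v)
  then show ?case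
    by (intro r_into_equivclp markov_move.relation) (auto simp: is_braid_append)
next
  case (sym u v)
  then show ?case
    using braid_eq_is_braid_iff equivclp_sym by metis
next
  case (trans u v w)
  then show ?case
    using braid_eq_is_braid_iff equivclp_trans by metis
qed auto

lemma word_inv_right: "is_braid n w \<Longrightarrow> braid_eq n (w @ word_inv w) []"
proof (induction w)
  case Nil
  show ?case by (simp add: word_inv_def braid_eq.refl)
next
  case (Cons l w)
  obtain i b where l: "l = (i, b)" by force
  have w: "is_braid n w" and i: "is_braid n [(i, b), (i, \<not> b)]" and e: "is_braid n []"
    using Cons.prems by (auto simp: is_braid_def l)
  have "braid_eq n ([l] @ (w @ word_inv w) @ [(i, \<not> b)]) ([l] @ [] @ [(i, \<not> b)])"
    by (intro braid_eq_context Cons.IH w)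
  also have "braid_eq n ([l] @ [] @ [(i, \<not> b)]) []"
    using braid_eq.rel[OF braid_relation.cancel i e, of "[]" "[]"] by (simp add: l)
  finally show ?case by (simp add: word_inv_def l)
qed

lemma equivclp_conjugate:
  assumes "is_braid n w" "is_braid n g" "braid_eq n (g @ w) (w' @ g)"
  shows "equivclp markov_move (n, w) (n, w')"
proof -
  have "equivclp markov_move (n, w) (n, g @ w @ word_inv g)"
    by (intro r_into_equivclp markov_move.conjugation assms)
  also have "equivclp markov_move (n, g @ w @ word_inv g) (n, w')"
  proof (rule braid_eq_imp_equivclp)
    have "braid_eq n ((g @ w) @ word_inv g) ((w' @ g) @ word_inv g)"
      by (intro braid_eq_append2 assms)
    also have "braid_eq n ((w' @ g) @ word_inv g) w'"
      using braid_eq_append1[OF word_inv_right[OF assms(2)], of w'] by simp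
    finally show "braid_eq n (g @ w @ word_inv g) w'" by simp
  qed (use assms in \<open>simp add: is_braid_append is_braid_word_inv\<close>)
  finally show ?thesis .
qed

text \<open>
  A word \<open>d\<close> that can be moved past single letters can be moved past a whole word. This is
  used with \<open>f\<close> the identity, the shift \<open>\<sigma>\<^sub>i \<mapsto> \<sigma>\<^bsub>i+1\<^esub>\<close>, and \<open>flip\<close>.
\<close>

lemma braid_eq_intertwine:
  assumes "\<And>l. l \<in> set w \<Longrightarrow> braid_eq n (l # d) (d @ [f l])"
  shows "braid_eq n (w @ d) (d @ map f w)"
  using assms
proof (induction w)
  case Nil
  show ?case by (simp add: braid_eq.refl)
next
  case (Cons l w)
  have "braid_eq n ([l] @ w @ d) ([l] @ d @ map f w)"
    by (intro braid_eq_append1 Cons) (use Cons.prems in auto)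
  also have "[l] @ d @ map f w = (l # d) @ map f w"
    by simp
  also have "braid_eq n ((l # d) @ map f w) ((d @ [f l]) @ map f w)"
    by (intro braid_eq_append2) (use Cons.prems in auto)
  finally show ?case by simp
qed

section \<open>The half twist\<close>

lemma set_sigma_down: "set (sigma_down b a) = sigma ` {a..b}"
  by (auto simp: sigma_down_def)

lemma sigma_down_Suc: "a \<le> Suc b \<Longrightarrow> sigma_down (Suc b) a = sigma (Suc b) # sigma_down b a"
  by (simp add: sigma_down_def)

lemma sigma_down_snoc: "a \<le> b \<Longrightarrow> sigma_down b a = sigma_down b (Suc a) @ [sigma a]"
  by (simp add: sigma_down_def upt_conv_Cons del: upt_Suc)

lemma braid_eq_commute:
  assumes "i + 2 \<le> j \<or> j + 2 \<le> i" "1 \<le> i" "1 \<le> j" "i < n" "j < n"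
  shows "braid_eq n [sigma i, sigma j] [sigma j, sigma i]"
proof -
  have "is_braid n [sigma i, sigma j]" "is_braid n [sigma j, sigma i]"
    using assms by (auto simp: is_braid_def sigma_def)
  then show ?thesis
    using assms(1) braid_eq.rel[of _ _ n "[]" "[]"] braid_relation.commute braid_eq.sym
    by (metis append_Nil append_Nil2)
qed

lemma sigma_commute_word:
  assumes "set w \<subseteq> sigma ` J" "\<And>j. j \<in> J \<Longrightarrow> (i + 2 \<le> j \<or> j + 2 \<le> i) \<and> 1 \<le> j \<and> j < n"
    and "1 \<le> i" "i < n"
  shows "braid_eq n (sigma i # w) (w @ [sigma i])"
proof -
  have "braid_eq n (w @ [sigma i]) ([sigma i] @ map (\<lambda>l. l) w)"
  proof (rule braid_eq_intertwine)
    fix l assume "l \<in> set w"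
    then obtain j where j: "l = sigma j" "j \<in> J"
      using assms(1) by blast
    show "braid_eq n [l, sigma i] ([sigma i] @ [l])"
      using braid_eq_commute[of j i n] assms(2)[OF j(2)] assms(3,4) by (auto simp: j(1))
  qed
  then show ?thesis using braid_eq.sym by simp
qed

text \<open>
  In \<open>\<sigma>\<^sub>m \<dots> \<sigma>\<^sub>1\<close> only the neighbours \<open>\<sigma>\<^bsub>i+1\<^esub> \<sigma>\<^sub>i\<close> obstruct the way of \<open>\<sigma>\<^sub>i\<close>, and there the braid relation
  \<open>\<sigma>\<^sub>i \<sigma>\<^bsub>i+1\<^esub> \<sigma>\<^sub>i = \<sigma>\<^bsub>i+1\<^esub> \<sigma>\<^sub>i \<sigma>\<^bsub>i+1\<^esub>\<close> lets it pass at the cost of raising its index.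
\<close>

lemma sigma_slide_down:
  assumes "1 \<le> i" "i < m" "m < n"
  shows "braid_eq n (sigma i # sigma_down m 1) (sigma_down m 1 @ [sigma (i + 1)])"
  using assms
proof (induction m)
  case 0
  then show ?case by simp
next
  case (Suc m)
  have D: "sigma_down (Suc m) 1 = sigma (Suc m) # sigma_down m 1"
    by (simp add: sigma_down_Suc)
  show ?case
  proof (cases "i = m")
    case False
    have "braid_eq n ([sigma i, sigma (Suc m)] @ sigma_down m 1)
        ([sigma (Suc m), sigma i] @ sigma_down m 1)"
      by (intro braid_eq_append2 braid_eq_commute) (use Suc.prems False in auto)
    also have "[sigma (Suc m), sigma i] @ sigma_down m 1 =
        [sigma (Suc m)] @ (sigma i # sigma_down m 1)"
      by simp
    also have "braid_eq n ([sigma (Suc m)] @ (sigma i # sigma_down m 1))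
        ([sigma (Suc m)] @ (sigma_down m 1 @ [sigma (i + 1)]))"
      by (intro braid_eq_append1 Suc.IH) (use Suc.prems False in auto)
    finally show ?thesis unfolding D by simp
  next
    case True
    define L where "L = sigma_down (m - 1) 1"
    have L: "sigma_down m 1 = sigma m # L"
      using Suc.prems True sigma_down_Suc[of 1 "m - 1"] by (simp add: L_def)
    have "is_braid n [sigma m, sigma (m + 1), sigma m]"
      "is_braid n [sigma (m + 1), sigma m, sigma (m + 1)]"
      using Suc.prems True by (auto simp: is_braid_def sigma_def)
    then have "braid_eq n ([sigma m, sigma (m + 1), sigma m] @ L)
        ([sigma (m + 1), sigma m, sigma (m + 1)] @ L)"
      using braid_eq.rel[OF braid_relation.braid, of n m "[]" L] by simp
    also have "[sigma (m + 1), sigma m, sigma (m + 1)] @ L =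
        [sigma (m + 1), sigma m] @ (sigma (m + 1) # L)"
      by simp
    also have "braid_eq n ([sigma (m + 1), sigma m] @ (sigma (m + 1) # L))
        ([sigma (m + 1), sigma m] @ (L @ [sigma (m + 1)]))"
      by (intro braid_eq_append1 sigma_commute_word[where J = "{1..m - 1}"])
        (use Suc.prems in \<open>auto simp: L_def set_sigma_down\<close>)
    finally show ?thesis unfolding D L True by simp
  qed
qed

text \<open>Garside's element \<open>\<Delta>\<^sub>m\<close>, the positive half twist on \<open>m\<close> strands.\<close>

fun half_twist :: "nat \<Rightarrow> braid_word" where
  "half_twist 0 = []"
| "half_twist (Suc m) = half_twist m @ sigma_down m 1"

lemma set_half_twist: "set (half_twist m) \<subseteq> sigma ` {1..<m}"
  by (induction m) (auto simp: set_sigma_down)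

lemma is_braid_half_twist: "1 \<le> n \<Longrightarrow> is_braid n (half_twist n)"
  using set_half_twist[of n] by (auto simp: is_braid_def sigma_def)

text \<open>
  Write \<open>D\<^sub>m = \<sigma>\<^sub>m \<dots> \<sigma>\<^sub>1\<close>. By \<open>sigma_slide_down\<close>, moving \<open>D\<^bsub>m-1\<^esub>\<close> past \<open>D\<^sub>m\<close> turns it into
  \<open>\<sigma>\<^sub>m \<dots> \<sigma>\<^sub>2\<close>, and the final \<open>\<sigma>\<^sub>1\<close> completes this to a second \<open>D\<^sub>m\<close>.
\<close>

lemma sigma_down_square:
  assumes "1 \<le> m" "m < n"
  shows "braid_eq n (sigma_down m 1 @ sigma_down m 1)
    (sigma_down (m - 1) 1 @ sigma_down m 1 @ [sigma 1])"
proof -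
  define shift where "shift = (\<lambda>(i, b). (i + 1, b) :: letter)"
  have "braid_eq n (sigma_down (m - 1) 1 @ sigma_down m 1)
      (sigma_down m 1 @ map shift (sigma_down (m - 1) 1))"
  proof (rule braid_eq_intertwine)
    fix l assume "l \<in> set (sigma_down (m - 1) 1)"
    then obtain i where "l = sigma i" "1 \<le> i" "i < m"
      using assms by (auto simp: set_sigma_down)
    then show "braid_eq n (l # sigma_down m 1) (sigma_down m 1 @ [shift l])"
      using sigma_slide_down[of i m n] assms by (simp add: shift_def sigma_def)
  qed
  moreover have "map shift (sigma_down (m - 1) 1) = sigma_down m 2"
  proof -
    have "map shift (map sigma [1..<m]) = map sigma (map Suc [1..<m])"
      by (simp add: shift_def sigma_def)
    then have "map shift (map sigma [1..<m]) = map sigma [2..<Suc m]"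
      by (simp only: map_Suc_upt numeral_2_eq_2 One_nat_def)
    then show ?thesis
      using assms by (simp add: sigma_down_def flip: rev_map)
  qed
  ultimately have "braid_eq n ((sigma_down (m - 1) 1 @ sigma_down m 1) @ [sigma 1])
      ((sigma_down m 1 @ sigma_down m 2) @ [sigma 1])"
    by (intro braid_eq_append2) simp
  moreover have "sigma_down m 1 = sigma_down m 2 @ [sigma 1]"
    using sigma_down_snoc[of 1 m] assms by (simp add: numeral_2_eq_2)
  ultimately show ?thesis using braid_eq.sym by fastforce
qed

text \<open>
  With \<open>\<Delta>\<^bsub>m+1\<^esub> = \<Delta>\<^sub>m D\<^sub>m\<close>, the induction hypothesis followed by \<open>sigma_slide_down\<close> handles every
  \<open>\<sigma>\<^sub>i\<close> with \<open>i < m\<close>. The new generator \<open>\<sigma>\<^sub>m\<close> requires unfolding \<open>\<Delta>\<^sub>m = \<Delta>\<^bsub>m-1\<^esub> D\<^bsub>m-1\<^esub>\<close> once more: it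
  commutes with \<open>\<Delta>\<^bsub>m-1\<^esub>\<close> and completes \<open>D\<^bsub>m-1\<^esub>\<close> to \<open>D\<^sub>m\<close>, so that \<open>sigma_down_square\<close> applies.
\<close>

lemma sigma_half_twist:
  assumes "1 \<le> i" "i < m" "m \<le> n"
  shows "braid_eq n (sigma i # half_twist m) (half_twist m @ [sigma (m - i)])"
  using assms
proof (induction m)
  case 0
  then show ?case by simp
next
  case (Suc m)
  show ?case
  proof (cases "i = m")
    case False
    have "braid_eq n ((sigma i # half_twist m) @ sigma_down m 1)
        ((half_twist m @ [sigma (m - i)]) @ sigma_down m 1)"
      by (intro braid_eq_append2 Suc.IH) (use Suc.prems False in auto)
    also have "(half_twist m @ [sigma (m - i)]) @ sigma_down m 1 =
        half_twist m @ (sigma (m - i) # sigma_down m 1)"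
      by simp
    also have "braid_eq n (half_twist m @ (sigma (m - i) # sigma_down m 1))
        (half_twist m @ (sigma_down m 1 @ [sigma (m - i + 1)]))"
      by (intro braid_eq_append1 sigma_slide_down) (use Suc.prems False in auto)
    finally show ?thesis using Suc.prems False by (simp add: Suc_diff_le)
  next
    case True
    obtain k where k: "m = Suc k" using Suc.prems True by (cases m) auto
    let ?H = "half_twist k"
    have "braid_eq n ((sigma m # ?H) @ (sigma_down k 1 @ sigma_down m 1))
        ((?H @ [sigma m]) @ (sigma_down k 1 @ sigma_down m 1))"
      by (intro braid_eq_append2 sigma_commute_word[OF set_half_twist])
        (use Suc.prems True k in auto)
    also have "(?H @ [sigma m]) @ (sigma_down k 1 @ sigma_down m 1)
        = ?H @ (sigma_down m 1 @ sigma_down m 1)"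
      by (simp add: k sigma_down_Suc)
    also have "braid_eq n (?H @ (sigma_down m 1 @ sigma_down m 1))
        (?H @ (sigma_down (m - 1) 1 @ sigma_down m 1 @ [sigma 1]))"
      by (intro braid_eq_append1 sigma_down_square) (use Suc.prems True in auto)
    finally show ?thesis by (simp add: True k)
  qed
qed

definition flip :: "nat \<Rightarrow> letter \<Rightarrow> letter" where
  "flip n = (\<lambda>(i, b). (n - i, b))"

lemma half_twist_flip:
  assumes "is_braid n w" "\<forall>l \<in> set w. snd l"
  shows "braid_eq n (w @ half_twist n) (half_twist n @ map (flip n) w)"
proof (rule braid_eq_intertwine)
  fix l assume l: "l \<in> set w"
  obtain i b where "l = (i, b)" by force
  with l assms have "l = sigma i" "1 \<le> i" "i < n"
    by (auto simp: is_braid_def sigma_def)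
  then show "braid_eq n (l # half_twist n) (half_twist n @ [flip n l])"
    using sigma_half_twist[of i n n] by (simp add: flip_def sigma_def)
qed

lemma is_braid_flip: "is_braid n w \<Longrightarrow> is_braid n (map (flip n) w)"
  by (force simp: is_braid_def flip_def)

lemma markov_equivalent_rotate_flip:
  assumes "is_braid n (u @ v)" "\<forall>l \<in> set (u @ v). snd l"
  shows "markov_equivalent (n, u @ v) (n, map (flip n) v @ map (flip n) u)"
proof -
  let ?f = "map (flip n)"
  have n: "1 \<le> n" using assms by (simp add: is_braid_def)
  have fu: "is_braid n (?f u)" and fv: "is_braid n (?f v)"
    using assms is_braid_flip by (auto simp: is_braid_append)
  have "equivclp markov_move (n, ?f v @ ?f u) (n, ?f u @ ?f v)"
    by (rule equivclp_conjugate[where g = "?f u"])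
      (use fu fv in \<open>auto simp: is_braid_append intro: braid_eq.refl\<close>)
  also have "equivclp markov_move (n, ?f u @ ?f v) (n, u @ v)"
    by (rule equivclp_conjugate[where g = "half_twist n"])
      (use fu fv n half_twist_flip[OF assms] in
        \<open>auto simp: is_braid_append is_braid_half_twist intro: braid_eq.sym\<close>)
  finally show ?thesis
    using fu fv assms by (simp add: markov_equivalent_def is_braid_append equivclp_sym)
qed

section \<open>Isotopies of the 3-sphere that preserve the braid axis\<close>

text \<open>
  In the coordinates of the solid torus, where \<open>(z, w)\<close> stands for the point \<open>z / |w|\<close> of the plane
  at the angle of \<open>w\<close>, this is the map \<open>z \<mapsto> a + e z\<close> of the plane together with multiplication of
  the angle by \<open>u\<close>. In this homogeneous form (multiplied by \<open>|w|\<close> and normalized) it makes sense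
  also on the braid axis \<open>w = 0\<close>, where for \<open>|e| = 1\<close> it is rotation by \<open>e\<close>.
\<close>

definition axis_map :: "complex \<Rightarrow> complex \<Rightarrow> complex \<Rightarrow> complex \<times> complex \<Rightarrow> complex \<times> complex" where
  "axis_map a e u = (\<lambda>(z, w). sgn (a * of_real (norm w) + e * z, u * w))"

lemma sgn_scaleR_pos:
  fixes x :: "complex \<times> complex"
  shows "r > 0 \<Longrightarrow> sgn (r *\<^sub>R x) = sgn x"
  by (simp add: sgn_scaleR)

text \<open>
  Before normalization the map is homogeneous of degree 1 for positive scalars, so normalizing
  the argument has no effect. So inverses and images of points of the solid torus can be
  computed without normalizing.
\<close>

lemma axis_map_sgn: "axis_map a e u (sgn x) = axis_map a e u x"
proof (cases "x = 0")
  case False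
  obtain z w where x: "x = (z, w)" by force
  define r where "r = inverse (norm x)"
  have r: "r > 0" using False by (simp add: r_def)
  have "sgn x = (r *\<^sub>R z, r *\<^sub>R w)"
    by (simp add: sgn_div_norm r_def x)
  then have "axis_map a e u (sgn x) = sgn (r *\<^sub>R (a * of_real (norm w) + e * z, u * w))"
    using r by (simp add: axis_map_def scaleR_conv_of_real algebra_simps norm_mult)
  also have "\<dots> = axis_map a e u x"
    using r by (simp add: sgn_scaleR_pos axis_map_def x del: scaleR_Pair)
  finally show ?thesis .
qed simp

lemma axis_map_inverse:
  assumes "norm e = 1" "norm u = 1" "norm x = 1"
  shows "axis_map (- a / e) (1 / e) (1 / u) (axis_map a e u x) = x"
proof -
  obtain z w where x: "x = (z, w)" by force
  have "e \<noteq> 0" "u \<noteq> 0" using assms by auto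
  then have "axis_map (- a / e) (1 / e) (1 / u) (a * of_real (norm w) + e * z, u * w) = sgn x"
    using assms(1,2) by (simp add: axis_map_def x norm_mult field_simps)
  then have "axis_map (- a / e) (1 / e) (1 / u) (axis_map a e u x) = sgn x"
    by (simp add: axis_map_sgn axis_map_def[of a e u] x)
  then show ?thesis using assms(3) by (simp add: sgn_div_norm)
qed

lemma axis_map_nonzero:
  assumes "e \<noteq> 0" "u \<noteq> 0" "(z, w) \<noteq> 0"
  shows "(a * of_real (norm w) + e * z, u * w) \<noteq> (0 :: complex \<times> complex)"
  using assms by (auto simp: zero_prod_def)

lemma axis_map_in_S3:
  assumes "e \<noteq> 0" "u \<noteq> 0" "x \<in> S3"
  shows "axis_map a e u x \<in> S3"
proof -
  obtain z w where x: "x = (z, w)" by force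
  have "x \<noteq> 0" using assms by auto
  then show ?thesis
    using axis_map_nonzero[OF assms(1,2), of z w a] by (simp add: axis_map_def x norm_sgn)
qed

lemma continuous_on_axis_map:
  fixes f :: "'a::topological_space \<Rightarrow> complex \<times> complex"
  assumes "continuous_on T a" "continuous_on T e" "continuous_on T u" "continuous_on T f"
    and "\<And>t. t \<in> T \<Longrightarrow> e t \<noteq> 0 \<and> u t \<noteq> 0 \<and> f t \<in> S3"
  shows "continuous_on T (\<lambda>t. axis_map (a t) (e t) (u t) (f t))"
proof -
  have "(a t * of_real (norm (snd (f t))) + e t * fst (f t), u t * snd (f t)) \<noteq> 0" if "t \<in> T" for t
  proof -
    have "(fst (f t), snd (f t)) \<noteq> 0"
      using assms(5)[OF that] by auto
    then show ?thesis
      using assms(5)[OF that] by (intro axis_map_nonzero) auto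
  qed
  then have "continuous_on T (\<lambda>t. sgn (a t * of_real (norm (snd (f t))) + e t * fst (f t), u t * snd (f t)))"
    by (intro continuous_on_sgn continuous_intros assms) auto
  then show ?thesis by (simp add: axis_map_def case_prod_beta)
qed

lemma homeomorphism_axis_map:
  assumes "norm e = 1" "norm u = 1"
  shows "homeomorphism S3 S3 (axis_map a e u) (axis_map (- a / e) (1 / e) (1 / u))"
proof -
  have nz: "e \<noteq> 0" "u \<noteq> 0" using assms by auto
  show ?thesis
  proof (rule homeomorphismI)
    show "continuous_on S3 (axis_map a e u)"
      using continuous_on_axis_map[of S3 "\<lambda>_. a" "\<lambda>_. e" "\<lambda>_. u" "\<lambda>x. x"] nz by simp
    show "continuous_on S3 (axis_map (- a / e) (1 / e) (1 / u))"
      using continuous_on_axis_map[of S3 "\<lambda>_. - a / e" "\<lambda>_. 1 / e" "\<lambda>_. 1 / u" "\<lambda>x. x"] nz by simp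
    show "axis_map a e u ` S3 \<subseteq> S3"
      using axis_map_in_S3[OF nz] by blast
    show "axis_map (- a / e) (1 / e) (1 / u) ` S3 \<subseteq> S3"
      using axis_map_in_S3[of "1 / e" "1 / u"] nz by (metis divide_eq_0_iff image_subsetI one_neq_zero)
    show "axis_map (- a / e) (1 / e) (1 / u) (axis_map a e u x) = x" if "x \<in> S3" for x
      using axis_map_inverse[OF assms] that by simp
    show "axis_map a e u (axis_map (- a / e) (1 / e) (1 / u) x) = x" if "x \<in> S3" for x
      using axis_map_inverse[of "1 / e" "1 / u" x "- a / e"] that assms nz
      by (simp add: norm_divide)
  qed
qed

lemma solid_torus_embedding_sgn: "solid_torus_embedding z t = sgn (z, cis (2 * pi * t))"
  by (simp add: solid_torus_embedding_def sgn_div_norm)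

lemma braid_closure_subset_S3: "braid_closure n w \<subseteq> S3"
proof -
  have "solid_torus_embedding z t \<in> S3" for z t
  proof -
    have "(z, cis (2 * pi * t)) \<noteq> 0"
      by (simp add: zero_prod_def)
    then show ?thesis
      by (simp add: solid_torus_embedding_sgn norm_sgn)
  qed
  then show ?thesis
    by (auto simp: braid_closure_def simp del: mem_sphere_0)
qed

lemma axis_map_solid_torus:
  "axis_map a e (cis (2 * pi * s)) (solid_torus_embedding z t) =
    solid_torus_embedding (a + e * z) (t + s)"
  unfolding solid_torus_embedding_sgn axis_map_sgn
  by (simp add: axis_map_def cis_mult algebra_simps)

lemma solid_torus_embedding_frac: "solid_torus_embedding z (frac t) = solid_torus_embedding z t"
proof -
  have "cis (2 * pi * t) = cis (2 * pi * frac t) * cis (2 * pi * of_int \<lfloor>t\<rfloor>)"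
    by (simp add: cis_mult frac_def algebra_simps)
  also have "cis (2 * pi * of_int \<lfloor>t\<rfloor>) = 1"
    by (rule cis_multiple_2pi) simp
  finally show ?thesis by (simp add: solid_torus_embedding_def)
qed

text \<open>
  The half turn \<open>z \<mapsto> a - z\<close> has the fixed point \<open>a / 2\<close>. At time \<open>t\<close> of the isotopy the plane is
  turned about this point by the angle \<open>\<pi> t\<close>, while the time coordinate of the solid torus is
  shifted by \<open>s t\<close>.
\<close>

lemma ambient_isotopic_half_turn:
  assumes "L \<subseteq> S3"
  shows "ambient_isotopic_S3 L (axis_map a (- 1) (cis (2 * pi * s)) ` L)"
proof -
  define H where
    "H = (\<lambda>t::real. axis_map (a / 2 * (1 - cis (pi * t))) (cis (pi * t)) (cis (2 * pi * (s * t))))"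
  have "continuous_on ({0..1} \<times> S3) (\<lambda>x. H (fst x) (snd x))"
    unfolding H_def by (rule continuous_on_axis_map) (auto intro!: continuous_intros)
  moreover have "\<forall>t \<in> {0..1}. \<exists>g. homeomorphism S3 S3 (H t) g"
    unfolding H_def by (metis homeomorphism_axis_map norm_cis)
  moreover have "\<forall>x \<in> S3. H 0 x = x"
    by (auto simp: H_def axis_map_def sgn_div_norm)
  moreover have "H 1 = axis_map a (- 1) (cis (2 * pi * s))"
    by (simp add: H_def mult.commute)
  moreover have "axis_map a (- 1) (cis (2 * pi * s)) ` L \<subseteq> S3"
    using axis_map_in_S3[of "- 1" "cis (2 * pi * s)"] assms by (auto simp del: mem_sphere_0)
  ultimately show ?thesis
    unfolding ambient_isotopic_S3_def using assms
    by (auto simp: case_prod_beta intro!: exI[of _ H])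
qed

section \<open>The half turn of a geometric braid\<close>

text \<open>
  The half turn exchanges the places \<open>i, i + 1\<close> with \<open>n + 1 - i, n - i\<close>, which is where
  \<open>\<sigma>\<^bsub>n-i\<^esub>\<close> acts, and as a rotation it preserves the sense of the crossing.
\<close>

lemma letter_path_flip:
  assumes "1 \<le> fst l" "fst l < n" "1 \<le> j" "j \<le> n"
  shows "letter_path (flip n l) s (n + 1 - j) = of_nat (n + 1) - letter_path l s j"
proof -
  obtain i b where l: "l = (i, b)" by force
  have "n + 1 - j = n - i \<longleftrightarrow> j = i + 1" "n + 1 - j = n - i + 1 \<longleftrightarrow> j = i"
    using assms by (auto simp: l)
  then show ?thesis
    using assms by (auto simp: l letter_path_def flip_def Let_def of_nat_diff field_simps)
qed

lemma letter_path_flip_image: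
  assumes "1 \<le> fst l" "fst l < n"
  shows "letter_path (flip n l) s ` {1..n} = (\<lambda>z. of_nat (n + 1) - z) ` letter_path l s ` {1..n}"
proof -
  have "{1..n} = (\<lambda>j. n + 1 - j) ` {1..n}"
  proof (intro equalityI subsetI)
    fix j assume "j \<in> {1..n}"
    then show "j \<in> (\<lambda>j. n + 1 - j) ` {1..n}"
      by (intro image_eqI[of _ _ "n + 1 - j"]) auto
  qed auto
  then have "letter_path (flip n l) s ` {1..n} = (\<lambda>j. letter_path (flip n l) s (n + 1 - j)) ` {1..n}"
    by (metis image_image)
  also have "\<dots> = (\<lambda>z. of_nat (n + 1) - z) ` letter_path l s ` {1..n}"
    unfolding image_image using letter_path_flip[OF assms] by (intro image_cong) auto
  finally show ?thesis .
qed

text \<open>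
  Rotating the word by \<open>m\<close> letters means reading it \<open>m\<close> letters later. Hence the slice at time \<open>t\<close>
  appears in the rotated word earlier by the fraction \<open>m / length w\<close> of a period.
\<close>

lemma braid_slice_rotate_flip:
  assumes w: "is_braid n w" "w \<noteq> []" and t: "0 \<le> t" "t < 1"
  shows "braid_slice n (rotate m (map (flip n) w)) (frac (t - m / length w)) =
    (\<lambda>z. of_nat (n + 1) - z) ` braid_slice n w t"
proof -
  define N where "N = length w"
  have N: "N > 0" using w by (simp add: N_def)
  define x where "x = t * real N"
  define x' where "x' = frac (t - m / N) * real N"
  \<comment> \<open>The shift in letters: \<open>m\<close>, corrected by full turns for the wrapping around of time.\<close>
  define c where "c = int m + \<lfloor>t - m / N\<rfloor> * int N"
  have x': "x' = x - of_int c"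
    using N by (simp add: x'_def x_def c_def frac_def field_simps)
  have fl: "\<lfloor>x'\<rfloor> = \<lfloor>x\<rfloor> - c" and fr: "frac x' = frac x"
    unfolding x' by (simp_all add: frac_def)
  have bnd: "0 \<le> x" "x < N" "0 \<le> x'" "x' < N"
    using t N frac_lt_1[of "t - m / N"] by (auto simp: x_def x'_def)
  have i: "nat \<lfloor>x\<rfloor> < N" "nat \<lfloor>x'\<rfloor> < N"
    using bnd by linarith+
  have "int ((nat \<lfloor>x'\<rfloor> + m) mod N) = (\<lfloor>x'\<rfloor> + int m) mod int N"
    using bnd by (simp add: zmod_int)
  also have "\<lfloor>x'\<rfloor> + int m = \<lfloor>x\<rfloor> + (- \<lfloor>t - m / N\<rfloor>) * int N"
    by (simp add: fl c_def)
  also have "\<dots> mod int N = \<lfloor>x\<rfloor> mod int N"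
    by (rule mod_mult_self1)
  also have "\<dots> = int (nat \<lfloor>x\<rfloor>)"
    using i bnd by simp
  finally have idx: "(m + nat \<lfloor>x'\<rfloor>) mod N = nat \<lfloor>x\<rfloor>"
    by (metis add.commute of_nat_eq_iff)
  have l: "rotate m (map (flip n) w) ! nat \<lfloor>x'\<rfloor> = flip n (w ! nat \<lfloor>x\<rfloor>)"
    using i idx by (simp add: nth_rotate N_def)
  have "w ! nat \<lfloor>x\<rfloor> \<in> set w" using i by (simp add: N_def)
  then have "1 \<le> fst (w ! nat \<lfloor>x\<rfloor>)" "fst (w ! nat \<lfloor>x\<rfloor>) < n"
    using w by (auto simp: is_braid_def)
  from letter_path_flip_image[OF this, of "frac x"] show ?thesis
    using w l fr by (simp add: braid_slice_def Let_def flip: x_def x'_def N_def)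
qed

lemma braid_closure_rotate_flip:
  assumes "is_braid n w" "w \<noteq> []"
  shows "braid_closure n (rotate m (map (flip n) w)) =
    axis_map (of_nat (n + 1)) (- 1) (cis (2 * pi * (- (m / length w)))) ` braid_closure n w"
    (is "braid_closure n ?w' = ?F ` _")
proof -
  define s where "s = m / length w"
  define r where "r = (\<lambda>t. frac (t - s))"
  have r: "{0..<1} = r ` {0..<1}"
  proof (intro equalityI subsetI)
    fix t :: real assume t: "t \<in> {0..<1}"
    have "r (frac (t + s)) = t"
    proof -
      have "frac (t + s) - s = t - of_int \<lfloor>t + s\<rfloor>" by (simp add: frac_def)
      then have "r (frac (t + s)) = frac t" by (simp add: r_def frac_def)
      then show ?thesis using t by (simp add: frac_eq)
    qed
    then show "t \<in> r ` {0..<1}"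
      by (intro image_eqI[of _ _ "frac (t + s)"]) (auto simp: frac_lt_1)
  qed (auto simp: r_def frac_lt_1)
  have "?F ` (\<lambda>z. solid_torus_embedding z t) ` braid_slice n w t =
      (\<lambda>z. solid_torus_embedding z (r t)) ` braid_slice n ?w' (r t)" if "t \<in> {0..<1}" for t
    using that braid_slice_rotate_flip[OF assms, of t m]
    unfolding axis_map_solid_torus image_image r_def solid_torus_embedding_frac
    by (simp add: s_def image_image)
  then have "?F ` braid_closure n w =
      (\<Union>t \<in> {0..<1}. (\<lambda>z. solid_torus_embedding z (r t)) ` braid_slice n ?w' (r t))"
    by (simp add: braid_closure_def image_UN)
  also have "\<dots> = (\<Union>t \<in> r ` {0..<1}. (\<lambda>z. solid_torus_embedding z t) ` braid_slice n ?w' t)"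
    by simp
  finally show ?thesis by (simp add: braid_closure_def flip: r)
qed

lemma ambient_isotopic_rotate_flip:
  assumes "is_braid n (u @ v)" "u @ v \<noteq> []"
  shows "ambient_isotopic_S3 (braid_closure n (u @ v))
    (braid_closure n (map (flip n) v @ map (flip n) u))"
proof -
  have "map (flip n) v @ map (flip n) u = rotate (length u) (map (flip n) (u @ v))"
    using rotate_append[of "map (flip n) u"] by simp
  then show ?thesis
    using braid_closure_rotate_flip[OF assms, of "length u"]
      ambient_isotopic_half_turn[OF braid_closure_subset_S3] by metis
qed

section \<open>The two families\<close>

lemma set_word_pow: "set (word_pow w p) \<subseteq> set w"
  by (auto simp: word_pow_def)

lemma map_word_pow: "map f (word_pow w p) = word_pow (map f w) p"
  by (simp add: word_pow_def map_concat)

lemma map_flip_sigma_down: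
  assumes "1 \<le> a" "b < n"
  shows "map (flip n) (sigma_down b a) = sigma_up (n - b) (n - a)"
proof (rule nth_equalityI)
  fix i assume "i < length (map (flip n) (sigma_down b a))"
  then show "map (flip n) (sigma_down b a) ! i = sigma_up (n - b) (n - a) ! i"
    using assms by (simp add: sigma_down_def sigma_up_def rev_nth flip_def sigma_def del: upt_Suc)
qed (use assms in \<open>auto simp: sigma_down_def sigma_up_def\<close>)

theorem mainTheorem3:
  fixes n p k q :: nat
  assumes "n \<ge> 3" and "p \<ge> 2" and "2 \<le> k" and "k \<le> n - 1" and "q \<ge> 1"
  shows "markov_equivalent (n, beta_V n p k q) (n, beta_BK n p k q) \<and>
         ambient_isotopic_S3 (braid_closure n (beta_V n p k q)) (braid_closure n (beta_BK n p k q))"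
proof -
  define u v where "u = word_pow (sigma_down (n - 1) 1) p"
    and "v = word_pow (sigma_down (n - 1) (n - k + 1)) (q * k)"
  have V: "beta_V n p k q = u @ v"
    by (simp add: beta_V_def u_def v_def)
  have BK: "beta_BK n p k q = map (flip n) v @ map (flip n) u"
    using assms by (simp add: beta_BK_def u_def v_def map_word_pow map_flip_sigma_down)
  have letters: "set (u @ v) \<subseteq> sigma ` {1..n - 1}"
    using set_word_pow[of "sigma_down (n - 1) 1" p]
      set_word_pow[of "sigma_down (n - 1) (n - k + 1)" "q * k"] assms
    by (fastforce simp: u_def v_def set_sigma_down)
  have "is_braid n [l] \<and> snd l" if l: "l \<in> set (u @ v)" for l
  proof -
    obtain i where "l = sigma i" "i \<in> {1..n - 1}"
      using letters l by blast
    then show ?thesis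
      using assms(1) by (auto simp: is_braid_def sigma_def)
  qed
  then have braid: "is_braid n (u @ v)" and pos: "\<forall>l \<in> set (u @ v). snd l"
    using assms(1) by (auto simp: is_braid_def)
  have "u \<noteq> []"
    using assms by (auto simp: u_def word_pow_def sigma_down_def)
  then show ?thesis
    using markov_equivalent_rotate_flip[OF braid pos] ambient_isotopic_rotate_flip[OF braid]
    by (simp add: V BK)
qed

end
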